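(* Let $(A_n,B_n)_{n\ge2}$ be the twin Seidel matrix sequence, $A_n=(a_n(m,k))$. Then, as formal power series in $x,y,z$, $$\sum a_{2n+1}(m,k)\frac{x^{m-1}}{(m-1)!}\frac{y^{k-m-1}}{(k-m-1)!}\frac{z^{2n-k}}{(2n-k)!}=\frac{\cos x\,\cos z}{\cos^2(x+y+z)},$$ the sum being over all integers $n\ge1$, $m,k$ with $2\le m+1\le k\le 2n$, and $$\sum a_{2n+1}(m,k)\frac{x^{2n-m}}{(2n-m)!}\frac{y^{m-k-1}}{(m-k-1)!}\frac{z^{k-1}}{(k-1)!}=\frac{\cos(x+y)\,\cos(y+z)}{\cos^2(x+y+z)},$$ the sum being over all integers $n\ge1$, $m,k$ with $2\le k+1\le m\le 2n$.
   Context: Twin Seidel matrix sequence: the unique sequence of square matrices $A_n=(a_n(m,k))_{1\le m,k\le n}$, $B_n=(b_n(m,k))_{1\le m,k\le n}$ ($n\ge2$) with nonnegative integer entries satisfying, with $a_n(m,\bullet)=\sum_k a_n(m,k)$, $a_n(\bullet,k)=\sum_m a_n(m,k)$ and similarly for $b$: (TS1) all diagonal entries are $0$, except $a_2(1,1)=1$; (TS2) for $n\ge3$: $a_n(m,n)=b_n(m,n)=0$ for all $m$, $a_n(n,k)=b_n(1,k)=0$ for all $k$, and $b_n(n,1)=0$; (TS3) $A_2=\begin{pmatrix}1&0\\0&0\end{pmatrix}$, $B_2=\begin{pmatrix}0&0\\1&0\end{pmatrix}$; (TS4) for $n\ge3$: $b_n(n,k)=a_{n-1}(\bullet,k-1)$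 for $2\le k\le n-1$; $b_n(n-1,k)=a_{n-1}(\bullet,k)$ for $1\le k\le n-2$; $b_n(m+1,k)-b_n(m,k)=a_{n-1}(m,k)$ for $2\le k+1\le m\le n-2$; $b_n(m+1,k)-b_n(m,k)=a_{n-1}(m,k-1)$ for $3\le m+2\le k\le n-1$; (TS5) for $n\ge3$: $a_n(1,k)=b_{n-1}(\bullet,k-1)$ for $2\le k\le n-1$; $a_n(m+1,k)-a_n(m,k)=-b_{n-1}(m,k-1)$ for $3\le m+2\le k\le n-1$; $a_n(m+1,k)-a_n(m,k)=-b_{n-1}(m,k)$ for $2\le k+1\le m\le n-1$. *)

theory Defs
  imports "HOL-Computational_Algebra.Formal_Power_Series"
begin

unbundle fps_syntax

section \<open>Twin Seidel matrix sequences\<close>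

text \<open>
  The entries \<open>a\<^sub>n(m,k)\<close> and \<open>b\<^sub>n(m,k)\<close> are written \<open>a n m k\<close> and \<open>b n m k\<close>; only the values with
  \<open>n \<ge> 2\<close> and \<open>1 \<le> m, k \<le> n\<close> are meaningful, and only those are constrained.
\<close>

definition col_sum :: "(nat \<Rightarrow> nat \<Rightarrow> nat \<Rightarrow> nat) \<Rightarrow> nat \<Rightarrow> nat \<Rightarrow> nat" where
  "col_sum a n k = (\<Sum>m=1..n. a n m k)"

definition TS1 :: "(nat \<Rightarrow> nat \<Rightarrow> nat \<Rightarrow> nat) \<Rightarrow> (nat \<Rightarrow> nat \<Rightarrow> nat \<Rightarrow> nat) \<Rightarrow> bool" where
  "TS1 a b \<longleftrightarrow>
     (\<forall>n\<ge>2. \<forall>m\<in>{1..n}. a n m m = (if n = 2 \<and> m = 1 then 1 else 0) \<and> b n m m = 0)"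

definition TS2 :: "(nat \<Rightarrow> nat \<Rightarrow> nat \<Rightarrow> nat) \<Rightarrow> (nat \<Rightarrow> nat \<Rightarrow> nat \<Rightarrow> nat) \<Rightarrow> bool" where
  "TS2 a b \<longleftrightarrow>
     (\<forall>n\<ge>3. (\<forall>m\<in>{1..n}. a n m n = 0 \<and> b n m n = 0) \<and>
            (\<forall>k\<in>{1..n}. a n n k = 0 \<and> b n 1 k = 0) \<and>
            b n n 1 = 0)"

definition TS3 :: "(nat \<Rightarrow> nat \<Rightarrow> nat \<Rightarrow> nat) \<Rightarrow> (nat \<Rightarrow> nat \<Rightarrow> nat \<Rightarrow> nat) \<Rightarrow> bool" where
  "TS3 a b \<longleftrightarrow>
     a 2 1 1 = 1 \<and> a 2 1 2 = 0 \<and> a 2 2 1 = 0 \<and> a 2 2 2 = 0 \<and>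
     b 2 1 1 = 0 \<and> b 2 1 2 = 0 \<and> b 2 2 1 = 1 \<and> b 2 2 2 = 0"

definition TS4 :: "(nat \<Rightarrow> nat \<Rightarrow> nat \<Rightarrow> nat) \<Rightarrow> (nat \<Rightarrow> nat \<Rightarrow> nat \<Rightarrow> nat) \<Rightarrow> bool" where
  "TS4 a b \<longleftrightarrow>
     (\<forall>n\<ge>3.
        (\<forall>k. 2 \<le> k \<and> k \<le> n - 1 \<longrightarrow> b n n k = col_sum a (n - 1) (k - 1)) \<and>
        (\<forall>k. 1 \<le> k \<and> k \<le> n - 2 \<longrightarrow> b n (n - 1) k = col_sum a (n - 1) k) \<and>
        (\<forall>m k. 2 \<le> k + 1 \<and> k + 1 \<le> m \<and> m \<le> n - 2 \<longrightarrow>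
           int (b n (m + 1) k) - int (b n m k) = int (a (n - 1) m k)) \<and>
        (\<forall>m k. 3 \<le> m + 2 \<and> m + 2 \<le> k \<and> k \<le> n - 1 \<longrightarrow>
           int (b n (m + 1) k) - int (b n m k) = int (a (n - 1) m (k - 1))))"

definition TS5 :: "(nat \<Rightarrow> nat \<Rightarrow> nat \<Rightarrow> nat) \<Rightarrow> (nat \<Rightarrow> nat \<Rightarrow> nat \<Rightarrow> nat) \<Rightarrow> bool" where
  "TS5 a b \<longleftrightarrow>
     (\<forall>n\<ge>3.
        (\<forall>k. 2 \<le> k \<and> k \<le> n - 1 \<longrightarrow> a n 1 k = col_sum b (n - 1) (k - 1)) \<and>
        (\<forall>m k. 3 \<le> m + 2 \<and> m + 2 \<le> k \<and> k \<le> n - 1 \<longrightarrow>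
           int (a n (m + 1) k) - int (a n m k) = - int (b (n - 1) m (k - 1))) \<and>
        (\<forall>m k. 2 \<le> k + 1 \<and> k + 1 \<le> m \<and> m \<le> n - 1 \<longrightarrow>
           int (a n (m + 1) k) - int (a n m k) = - int (b (n - 1) m k)))"

definition twin_seidel :: "(nat \<Rightarrow> nat \<Rightarrow> nat \<Rightarrow> nat) \<Rightarrow> (nat \<Rightarrow> nat \<Rightarrow> nat \<Rightarrow> nat) \<Rightarrow> bool" where
  "twin_seidel a b \<longleftrightarrow> TS1 a b \<and> TS2 a b \<and> TS3 a b \<and> TS4 a b \<and> TS5 a b"

text \<open>Existence and uniqueness (up to the meaningless values) of the twin Seidel matrix sequence.\<close>

fun ts_a ts_b :: "nat \<Rightarrow> nat \<Rightarrow> nat \<Rightarrow> nat" where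
  "ts_a 0 m k = 0"
| "ts_a (Suc n) m k =
     (if n < 2 then (if m = 1 \<and> k = 1 then 1 else 0)
      else if m < k \<and> k \<le> n then (\<Sum>i=m..n. ts_b n i (k - 1))
      else if k < m \<and> m \<le> n then (\<Sum>i=m..n. ts_b n i k)
      else 0)"
| "ts_b 0 m k = 0"
| "ts_b (Suc n) m k =
     (if n < 2 then (if m = 2 \<and> k = 1 then 1 else 0)
      else if m = Suc n then (if 2 \<le> k \<and> k \<le> n then (\<Sum>i=1..n. ts_a n i (k - 1)) else 0)
      else if m < k \<and> k \<le> n then (\<Sum>i=1..<m. ts_a n i (k - 1))
      else if k < m \<and> m \<le> n then (\<Sum>i=1..<m. ts_a n i k)
      else 0)"

declare ts_a.simps(2) [simp del] ts_b.simps(2) [simp del]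

lemma ts_a_bottom: "2 \<le> n \<Longrightarrow> ts_a n n k = 0"
  by (cases n) (simp_all add: ts_a.simps(2))

lemma twin_seidel_exists: "twin_seidel ts_a ts_b"
proof -
  have A: "ts_a n m k =
     (if m < k \<and> k \<le> n - 1 then (\<Sum>i=m..n-1. ts_b (n-1) i (k - 1))
      else if k < m \<and> m \<le> n - 1 then (\<Sum>i=m..n-1. ts_b (n-1) i k)
      else 0)" if "n \<ge> 3" for n m k
    using that by (cases n) (simp_all add: ts_a.simps(2))
  have B: "ts_b n m k =
     (if m = n then (if 2 \<le> k \<and> k \<le> n - 1 then (\<Sum>i=1..n-1. ts_a (n-1) i (k - 1)) else 0)
      else if m < k \<and> k \<le> n - 1 then (\<Sum>i=1..<m. ts_a (n-1) i (k - 1))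
      else if k < m \<and> m \<le> n - 1 then (\<Sum>i=1..<m. ts_a (n-1) i k)
      else 0)" if "n \<ge> 3" for n m k
    using that by (cases n) (simp_all add: ts_b.simps(2))
  have A2: "ts_a 2 m k = (if m = 1 \<and> k = 1 then 1 else 0)" for m k
    by (simp add: numeral_2_eq_2 ts_a.simps)
  have B2: "ts_b 2 m k = (if m = 2 \<and> k = 1 then 1 else 0)" for m k
    by (simp add: numeral_2_eq_2 ts_b.simps)
  have 1: "TS1 ts_a ts_b"
    unfolding TS1_def
  proof (intro allI impI ballI)
    fix n m :: nat assume "2 \<le> n" "m \<in> {1..n}"
    then show "ts_a n m m = (if n = 2 \<and> m = 1 then 1 else 0) \<and> ts_b n m m = 0"
      by (cases "n = 2") (auto simp: A[of n] A2 B[of n] B2)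
  qed
  have 2: "TS2 ts_a ts_b"
    unfolding TS2_def
  proof (intro allI impI)
    fix n :: nat assume "3 \<le> n"
    then show "(\<forall>m\<in>{1..n}. ts_a n m n = 0 \<and> ts_b n m n = 0) \<and>
        (\<forall>k\<in>{1..n}. ts_a n n k = 0 \<and> ts_b n 1 k = 0) \<and> ts_b n n 1 = 0"
      by (auto simp: A[of n] B[of n])
  qed
  have 3: "TS3 ts_a ts_b"
    unfolding TS3_def by (simp add: A2 B2)
  have 4: "TS4 ts_a ts_b"
    unfolding TS4_def
  proof (intro allI impI conjI)
    fix n k :: nat assume "3 \<le> n" "2 \<le> k \<and> k \<le> n - 1"
    then show "ts_b n n k = col_sum ts_a (n - 1) (k - 1)"
      by (simp add: B[of n] col_sum_def)
  next
    fix n k :: nat assume n: "3 \<le> n" and k: "1 \<le> k \<and> k \<le> n - 2"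
    have "{1..n-1} = insert (n-1) {1..<n-1}" using n by auto
    then have "(\<Sum>i=1..n-1. ts_a (n-1) i k) = (\<Sum>i=1..<n-1. ts_a (n-1) i k)"
      using n by (simp add: ts_a_bottom)
    then show "ts_b n (n - 1) k = col_sum ts_a (n - 1) k"
      using n k by (auto simp: B[of n] col_sum_def)
  next
    fix n m k :: nat assume "3 \<le> n" "2 \<le> k + 1 \<and> k + 1 \<le> m \<and> m \<le> n - 2"
    then show "int (ts_b n (m + 1) k) - int (ts_b n m k) = int (ts_a (n - 1) m k)"
      by (auto simp: B[of n] sum.atLeastLessThan_Suc)
  next
    fix n m k :: nat assume "3 \<le> n" "3 \<le> m + 2 \<and> m + 2 \<le> k \<and> k \<le> n - 1"
    then show "int (ts_b n (m + 1) k) - int (ts_b n m k) = int (ts_a (n - 1) m (k - 1))"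
      by (auto simp: B[of n] sum.atLeastLessThan_Suc)
  qed
  have 5: "TS5 ts_a ts_b"
    unfolding TS5_def
  proof (intro allI impI conjI)
    fix n k :: nat assume "3 \<le> n" "2 \<le> k \<and> k \<le> n - 1"
    then show "ts_a n 1 k = col_sum ts_b (n - 1) (k - 1)"
      by (simp add: A[of n] col_sum_def)
  next
    fix n m k :: nat assume "3 \<le> n" "3 \<le> m + 2 \<and> m + 2 \<le> k \<and> k \<le> n - 1"
    then show "int (ts_a n (m + 1) k) - int (ts_a n m k) = - int (ts_b (n - 1) m (k - 1))"
      by (auto simp: A[of n] sum.atLeast_Suc_atMost)
  next
    fix n m k :: nat assume "3 \<le> n" "2 \<le> k + 1 \<and> k + 1 \<le> m \<and> m \<le> n - 1"
    then show "int (ts_a n (m + 1) k) - int (ts_a n m k) = - int (ts_b (n - 1) m k)"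
      by (auto simp: A[of n] sum.atLeast_Suc_atMost)
  qed
  show ?thesis
    unfolding twin_seidel_def using 1 2 3 4 5 by blast
qed

lemma twin_seidel_unique_step:
  assumes ts: "twin_seidel a b" "twin_seidel a' b'" and n: "n \<ge> 3"
    and IH: "\<And>m k. m \<in> {1..n-1} \<Longrightarrow> k \<in> {1..n-1} \<Longrightarrow>
               a (n-1) m k = a' (n-1) m k \<and> b (n-1) m k = b' (n-1) m k"
    and m: "m \<in> {1..n}" and k: "k \<in> {1..n}"
  shows "a n m k = a' n m k \<and> b n m k = b' n m k"
proof -
  have ca: "col_sum a (n-1) j = col_sum a' (n-1) j" and cb: "col_sum b (n-1) j = col_sum b' (n-1) j"
    if "j \<in> {1..n-1}" for j
    using IH that by (auto simp: col_sum_def intro!: sum.cong)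
  have T1: "TS1 a b" "TS1 a' b'" and T2: "TS2 a b" "TS2 a' b'"
    and T4: "TS4 a b" "TS4 a' b'" and T5: "TS5 a b" "TS5 a' b'"
    using ts by (auto simp: twin_seidel_def)
  consider "k = n" | "k = m" | "m < k" "k \<le> n - 1" | "k < m" "m \<le> n"
    using m k by force
  then show ?thesis
  proof cases
    case 1
    then show ?thesis using T2 n m by (auto simp: TS2_def)
  next
    case 2
    then show ?thesis using T1 n m by (auto simp: TS1_def)
  next
    case 3
    have "m < k \<longrightarrow> a n m k = a' n m k \<and> b n m k = b' n m k"
      using m
    proof (induction m)
      case 0
      then show ?case by simp
    next
      case (Suc m)
      show ?case
      proof (cases "m = 0")
        case True
        have "a n 1 k = a' n 1 k" if "1 < k"
        proof -
          have "a n 1 k = col_sum b (n-1) (k-1)" "a' n 1 k = col_sum b' (n-1) (k-1)"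
            using T5 n 3 that by (auto simp: TS5_def)
          moreover have "k - 1 \<in> {1..n-1}" using that 3(2) unfolding atLeastAtMost_iff by linarith
          ultimately show ?thesis using cb by simp
        qed
        moreover have "b n 1 k = 0" "b' n 1 k = 0"
          using T2 n k by (auto simp: TS2_def)
        ultimately show ?thesis using True by auto
      next
        case False
        show ?thesis
        proof
          assume mk: "Suc m < k"
          then have ih: "a n m k = a' n m k \<and> b n m k = b' n m k"
            using Suc False by auto
          have r: "3 \<le> m + 2 \<and> m + 2 \<le> k \<and> k \<le> n - 1"
            using mk False 3 by auto
          have "int (a n (m+1) k) - int (a n m k) = - int (b (n-1) m (k-1))"
               "int (a' n (m+1) k) - int (a' n m k) = - int (b' (n-1) m (k-1))"
            using T5 n r unfolding TS5_def by blast+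
          moreover have "int (b n (m+1) k) - int (b n m k) = int (a (n-1) m (k-1))"
               "int (b' n (m+1) k) - int (b' n m k) = int (a' (n-1) m (k-1))"
            using T4 n r unfolding TS4_def by blast+
          moreover have "a (n-1) m (k-1) = a' (n-1) m (k-1) \<and> b (n-1) m (k-1) = b' (n-1) m (k-1)"
            by (rule IH) (use r in auto)
          ultimately show "a n (Suc m) k = a' n (Suc m) k \<and> b n (Suc m) k = b' n (Suc m) k"
            using ih by simp
        qed
      qed
    qed
    then show ?thesis using 3 by simp
  next
    case 4
    have Aeq: "a n m k = a' n m k"
      using 4(2,1)
    proof (induction m rule: inc_induct)
      case base
      then show ?case using T2 n k by (auto simp: TS2_def)
    next
      case (step m)
      have r: "2 \<le> k + 1 \<and> k + 1 \<le> m \<and> m \<le> n - 1"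
        using step k by auto
      have "int (a n (m+1) k) - int (a n m k) = - int (b (n-1) m k)"
           "int (a' n (m+1) k) - int (a' n m k) = - int (b' (n-1) m k)"
        using T5 n r unfolding TS5_def by blast+
      moreover have "a (n-1) m k = a' (n-1) m k \<and> b (n-1) m k = b' (n-1) m k"
        by (rule IH) (use r in auto)
      ultimately show ?case using step by simp
    qed
    have Bn: "b n n k = b' n n k" if "k \<le> n - 1"
    proof (cases "k = 1")
      case True
      then show ?thesis using T2 n by (auto simp: TS2_def)
    next
      case False
      then have "2 \<le> k \<and> k \<le> n - 1" using k that by auto
      then have "b n n k = col_sum a (n-1) (k-1)" "b' n n k = col_sum a' (n-1) (k-1)"
        using T4 n unfolding TS4_def by blast+
      moreover have "k - 1 \<in> {1..n-1}" using \<open>2 \<le> k \<and> k \<le> n - 1\<close>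
        unfolding atLeastAtMost_iff by linarith
      ultimately show ?thesis using ca by simp
    qed
    have Bm: "b n m k = b' n m k" if "m \<le> n - 1"
      using that 4(1)
    proof (induction m rule: inc_induct)
      case base
      then have "1 \<le> k \<and> k \<le> n - 2" using k by auto
      then have "b n (n-1) k = col_sum a (n-1) k" "b' n (n-1) k = col_sum a' (n-1) k"
        using T4 n unfolding TS4_def by blast+
      then show ?case using ca[of k] \<open>1 \<le> k \<and> k \<le> n - 2\<close> by auto
    next
      case (step m)
      have r: "2 \<le> k + 1 \<and> k + 1 \<le> m \<and> m \<le> n - 2"
        using step k by auto
      have "int (b n (m+1) k) - int (b n m k) = int (a (n-1) m k)"
           "int (b' n (m+1) k) - int (b' n m k) = int (a' (n-1) m k)"
        using T4 n r unfolding TS4_def by blast+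
      moreover have "a (n-1) m k = a' (n-1) m k \<and> b (n-1) m k = b' (n-1) m k"
        by (rule IH) (use r in auto)
      ultimately show ?case using step by simp
    qed
    show ?thesis
      using Aeq Bn Bm 4 by (cases "m = n") auto
  qed
qed

lemma twin_seidel_unique:
  assumes "twin_seidel a b" "twin_seidel a' b'" and "n \<ge> 2" "m \<in> {1..n}" "k \<in> {1..n}"
  shows "a n m k = a' n m k \<and> b n m k = b' n m k"
  using assms(3-5)
proof (induction n arbitrary: m k rule: dec_induct)
  case base
  have "m = 1 \<or> m = 2" "k = 1 \<or> k = 2" using base by auto
  then show ?case using assms(1,2) by (auto simp: twin_seidel_def TS3_def)
next
  case (step n)
  show ?case
    by (rule twin_seidel_unique_step[OF assms(1,2)]) (use step in auto)
qed


section \<open>Formal power series in three variables\<close>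

text \<open>
  \<open>\<rat>[[x,y,z]]\<close> is the ring \<open>\<rat>[[z]][[y]][[x]]\<close> of iterated series, with \<open>F $ i $ j $ l\<close> the coefficient of
  \<open>x\<^sup>i y\<^sup>j z\<^sup>l\<close>. The library's metric on \<open>fps\<close> only sees the outermost variable, so infinite sums of
  trivariate series are taken coefficientwise here.
\<close>

type_synonym fps3 = "rat fps fps fps"

definition varx :: fps3 where "varx = fps_X"
definition vary :: fps3 where "vary = fps_const fps_X"
definition varz :: fps3 where "varz = fps_const (fps_const fps_X)"

definition const3 :: "rat \<Rightarrow> fps3" where
  "const3 c = fps_const (fps_const (fps_const c))"

definition formal_summable :: "('t \<Rightarrow> fps3) \<Rightarrow> 't set \<Rightarrow> bool" where
  "formal_summable F I \<longleftrightarrow> (\<forall>i j l. finite {t\<in>I. F t $ i $ j $ l \<noteq> 0})"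

definition formal_sum :: "('t \<Rightarrow> fps3) \<Rightarrow> 't set \<Rightarrow> fps3" where
  "formal_sum F I =
     Abs_fps (\<lambda>i. Abs_fps (\<lambda>j. Abs_fps (\<lambda>l. \<Sum>t | t \<in> I \<and> F t $ i $ j $ l \<noteq> 0. F t $ i $ j $ l)))"

definition has_formal_sum :: "('t \<Rightarrow> fps3) \<Rightarrow> 't set \<Rightarrow> fps3 \<Rightarrow> bool" where
  "has_formal_sum F I S \<longleftrightarrow> formal_summable F I \<and> formal_sum F I = S"

text \<open>Substitution of \<open>g\<close>, a series without constant term, into a univariate series \<open>f\<close>.\<close>

definition subst3 :: "rat fps \<Rightarrow> fps3 \<Rightarrow> fps3" where
  "subst3 f g = formal_sum (\<lambda>n. const3 (f $ n) * g ^ n) UNIV"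

definition cos3 :: "fps3 \<Rightarrow> fps3" where
  "cos3 g = subst3 (fps_cos 1) g"

lemma mult3_nth:
  fixes F G :: fps3
  shows "(F * G) $ i $ j $ l =
    (\<Sum>i'=0..i. \<Sum>j'=0..j. \<Sum>l'=0..l. F $ i' $ j' $ l' * G $ (i - i') $ (j - j') $ (l - l'))"
  by (simp add: fps_mult_nth fps_sum_nth)

lemma power3_nth_eq_0:
  fixes g :: fps3
  assumes "g $ 0 $ 0 $ 0 = 0" "i + j + l < n"
  shows "(g ^ n) $ i $ j $ l = 0"
  using assms(2)
proof (induction n arbitrary: i j l)
  case (Suc n)
  have "g $ i' $ j' $ l' * (g ^ n) $ (i - i') $ (j - j') $ (l - l') = 0"
    if "i' \<le> i" "j' \<le> j" "l' \<le> l" for i' j' l'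
  proof (cases "i' + j' + l' = 0")
    case True
    then show ?thesis using assms(1) by simp
  next
    case False
    then have "(i - i') + (j - j') + (l - l') < n" using Suc.prems that by linarith
    then show ?thesis using Suc.IH by simp
  qed
  then show ?case unfolding power_Suc mult3_nth by (intro sum.neutral ballI) simp
qed simp

lemma const3_mult_nth: "(const3 c * F) $ i $ j $ l = c * F $ i $ j $ l"
  by (simp add: const3_def)

lemma formal_summable_subst3:
  assumes "g $ 0 $ 0 $ 0 = 0"
  shows "formal_summable (\<lambda>n. const3 (f $ n) * g ^ n) UNIV"
  unfolding formal_summable_def
proof (intro allI)
  fix i j l
  have "{n \<in> UNIV. (const3 (f $ n) * g ^ n) $ i $ j $ l \<noteq> 0} \<subseteq> {..i + j + l}"
    using power3_nth_eq_0[OF assms, of i j l] by (force simp: const3_mult_nth not_le[symmetric])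
  then show "finite {n \<in> UNIV. (const3 (f $ n) * g ^ n) $ i $ j $ l \<noteq> 0}"
    using finite_subset by blast
qed

lemma subst3_nth:
  assumes "g $ 0 $ 0 $ 0 = 0"
  shows "subst3 f g $ i $ j $ l = (\<Sum>n\<le>i+j+l. f $ n * (g ^ n) $ i $ j $ l)"
proof -
  have "subst3 f g $ i $ j $ l =
      (\<Sum>n | (const3 (f $ n) * g ^ n) $ i $ j $ l \<noteq> 0. (const3 (f $ n) * g ^ n) $ i $ j $ l)"
    by (simp add: subst3_def formal_sum_def)
  also have "\<dots> = (\<Sum>n\<le>i+j+l. f $ n * (g ^ n) $ i $ j $ l)"
    by (rule sum.mono_neutral_cong_left)
       (use power3_nth_eq_0[OF assms, of i j l] in \<open>force simp: const3_mult_nth not_le[symmetric]\<close>)+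
  finally show ?thesis .
qed

text \<open>
  The library defines \<open>inverse\<close> and \<open>/\<close> on \<open>'a fps\<close> from \<open>inverse\<close> on \<open>'a\<close>, so they are available on iterated
  series; they are the genuine ring operations on series with nonzero constant term.
\<close>

lemma fps3_divide:
  fixes F G :: fps3
  assumes "G $ 0 $ 0 $ 0 \<noteq> 0"
  shows "F / G * G = F"
proof -
  have 1: "(G $ 0 $ 0) * inverse (G $ 0 $ 0) = 1"
    using assms by (simp add: inverse_mult_eq_1')
  have 2: "(G $ 0) * inverse (G $ 0) = 1"
    unfolding fps_inverse_def[of "G $ 0"] by (rule fps_right_inverse[OF 1])
  have 3: "G * inverse G = 1"
    unfolding fps_inverse_def[of G] by (rule fps_right_inverse[OF 2])
  have "G $ 0 \<noteq> 0" using assms by auto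
  then have "F / G = F * inverse G"
    by (simp add: fps_divide_def)
  then show ?thesis using 3 by (simp add: mult.assoc mult.commute[of _ G])
qed

lemma cos3_nth_0: "g $ 0 $ 0 $ 0 = 0 \<Longrightarrow> cos3 g $ 0 $ 0 $ 0 = 1"
  by (simp add: cos3_def subst3_nth)

end

theory Submission
  imports Defs
begin

text \<open>
  Index the strictly upper and strictly lower entries of \<open>a\<^sub>n\<close> and \<open>b\<^sub>n\<close> by the exponents \<open>(i,j,l)\<close> of
  the monomials they accompany, so that \<open>n = i + j + l + 3\<close>. In terms of the exponential generating
  functions, the difference equations of TS4 and TS5 say that \<open>\<partial>\<^sub>x - \<partial>\<^sub>y\<close> rotates the pair (a, b), above
  and below the diagonal. Summing them along a column shows that the entries next to the diagonal
  are symmetric, which glues the upper series to the lower one, and the bottom rows give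
  \<open>\<partial>\<^sub>z L\<^sub>a = L\<^sub>b\<close> on \<open>x = 0\<close> and \<open>L\<^sub>a = 1\<close> on \<open>x = z = 0\<close>. These relations only couple \<open>a\<^sub>n\<close> for odd \<open>n\<close> with \<open>b\<^sub>n\<close>
  for even \<open>n\<close>, and they determine all coefficients. With \<open>C = cos (x + y + z)\<close> they are also satisfied by
  \<open>U\<^sub>a = cos x cos z / C\<^sup>2\<close>, \<open>U\<^sub>b = sin x cos z / C\<^sup>2\<close>, \<open>L\<^sub>a = cos (x + y) cos (y + z) / C\<^sup>2\<close> and
  \<open>L\<^sub>b = cos (x + y) sin (y + z) / C\<^sup>2\<close>, because \<open>\<partial>\<^sub>x - \<partial>\<^sub>y\<close> annihilates \<open>C\<close>.
\<close>

section \<open>The linear recursion\<close>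

text \<open>The arguments are exponents, so on exponential coefficients an index shift is a partial
  derivative. The clauses come in the order in which they fix a given total degree:
  \<open>ub\<close>, \<open>lb\<close>, \<open>la\<close>, \<open>ua\<close>.\<close>

definition twin_rec ::
  "(nat \<Rightarrow> nat \<Rightarrow> nat \<Rightarrow> rat) \<Rightarrow> (nat \<Rightarrow> nat \<Rightarrow> nat \<Rightarrow> rat) \<Rightarrow>
   (nat \<Rightarrow> nat \<Rightarrow> nat \<Rightarrow> rat) \<Rightarrow> (nat \<Rightarrow> nat \<Rightarrow> nat \<Rightarrow> rat) \<Rightarrow> bool" where
  "twin_rec ua ub la lb \<longleftrightarrow>
     (\<forall>j l. ub 0 j l = 0) \<and>
     (\<forall>i j l. ub (Suc i) j l = ub i (Suc j) l + ua i j l) \<and>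
     (\<forall>i l. lb i 0 l = ub l 0 i) \<and>
     (\<forall>i j l. lb i (Suc j) l = lb (Suc i) j l + la i j l) \<and>
     (\<forall>j. la 0 j 0 = (if j = 0 then 1 else 0)) \<and>
     (\<forall>j l. la 0 j (Suc l) = lb 0 j l) \<and>
     (\<forall>i j l. la (Suc i) j l = la i (Suc j) l + lb i j l) \<and>
     (\<forall>i l. ua i 0 l = la l 0 i) \<and>
     (\<forall>i j l. ua i (Suc j) l = ua (Suc i) j l + ub i j l)"

text \<open>Induction on the total degree \<open>d\<close>. Each rotation clause trades
  \<open>i\<close> against \<open>j\<close> within degree \<open>d\<close> at the cost of a term of
  degree \<open>d - 1\<close>, so an inner induction along one exponent reduces to a boundary
  clause.\<close>

lemma twin_rec_unique:
  assumes "twin_rec ua ub la lb" "twin_rec ua' ub' la' lb'"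
  shows "ua i j l = ua' i j l \<and> la i j l = la' i j l"
proof -
  note R = assms[unfolded twin_rec_def]
  have "\<forall>i j l. i + j + l = d \<longrightarrow> ua i j l = ua' i j l \<and> ub i j l = ub' i j l \<and>
          la i j l = la' i j l \<and> lb i j l = lb' i j l" for d
  proof (induction d rule: less_induct)
    case (less d)
    have IH: "ua i j l = ua' i j l" "ub i j l = ub' i j l" "la i j l = la' i j l" "lb i j l = lb' i j l"
      if "i + j + l < d" for i j l
      using less.IH[OF that] by blast+
    have ub: "ub i j l = ub' i j l" if "i + j + l = d" for i j l
      using that
    proof (induction i arbitrary: j)
      case (Suc i)
      have "ub i (Suc j) l = ub' i (Suc j) l" using Suc by simp
      moreover have "ua i j l = ua' i j l" using Suc IH by simp
      ultimately show ?case using R by simp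
    qed (use R in simp)
    have lb: "lb i j l = lb' i j l" if "i + j + l = d" for i j l
      using that
    proof (induction j arbitrary: i)
      case 0
      then show ?case using R ub[of l 0 i] by simp
    next
      case (Suc j)
      have "lb (Suc i) j l = lb' (Suc i) j l" using Suc by simp
      moreover have "la i j l = la' i j l" using Suc IH by simp
      ultimately show ?case using R by simp
    qed
    have la: "la i j l = la' i j l" if "i + j + l = d" for i j l
      using that
    proof (induction i arbitrary: j)
      case 0
      \<comment> \<open>A positive \<open>l\<close> leads to \<open>lb\<close> in degree
        \<open>d - 1\<close>, covered by the outer hypothesis; \<open>l = 0\<close> is the
        prescribed seed.\<close>
      then show ?case using R IH(4)[of 0 j "l - 1"] by (cases l) simp_all
    next
      case (Suc i)
      have "la i (Suc j) l = la' i (Suc j) l" using Suc by simp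
      moreover have "lb i j l = lb' i j l" using Suc IH by simp
      ultimately show ?case using R by simp
    qed
    have ua: "ua i j l = ua' i j l" if "i + j + l = d" for i j l
      using that
    proof (induction j arbitrary: i)
      case 0
      then show ?case using R la[of l 0 i] by simp
    next
      case (Suc j)
      have "ua (Suc i) j l = ua' (Suc i) j l" using Suc by simp
      moreover have "ub i j l = ub' i j l" using Suc IH by simp
      ultimately show ?case using R by simp
    qed
    show ?case using ua ub la lb by blast
  qed
  then show ?thesis by blast
qed

section \<open>The entries of the twin Seidel matrices\<close>

text \<open>The top row entry \<open>a (Suc n) 1 (Suc k)\<close> is a column sum of
  \<open>b n\<close>. By TS5 the part above the diagonal telescopes along column
  \<open>Suc k\<close>, the part below along column \<open>k\<close> down to the zero bottom row;
  the top row entry then cancels.\<close>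

lemma twin_seidel_a_symmetric:
  assumes "twin_seidel a b" "1 \<le> k" "k < n" "2 \<le> n"
  shows "a (Suc n) k (Suc k) = a (Suc n) (Suc k) k"
proof -
  have T: "TS1 a b" "TS2 a b" "TS5 a b" using assms(1) by (auto simp: twin_seidel_def)
  have split: "{1..n} = {1..k-1} \<union> {k} \<union> {Suc k..n}" using assms by auto
  have "int (a (Suc n) 1 (Suc k)) = int (col_sum b n k)"
    using T(3)[unfolded TS5_def, rule_format, of "Suc n"] assms by simp
  also have "\<dots> = (\<Sum>m=1..k-1. int (b n m k)) + int (b n k k) + (\<Sum>m=Suc k..n. int (b n m k))"
    unfolding col_sum_def split using assms by (subst sum.union_disjoint; simp)+
  also have "b n k k = 0"
    using T(1) assms by (simp add: TS1_def)
  also have "(\<Sum>m=1..k-1. int (b n m k)) =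
      - (\<Sum>m=1..k-1. int (a (Suc n) (Suc m) (Suc k)) - int (a (Suc n) m (Suc k)))"
    unfolding sum_negf[symmetric]
  proof (rule sum.cong)
    fix m assume "m \<in> {1..k-1}"
    then have "int (a (Suc n) (m+1) (Suc k)) - int (a (Suc n) m (Suc k)) = - int (b n m k)"
      using T(3)[unfolded TS5_def, rule_format, of "Suc n"] assms by force
    then show "int (b n m k) = - (int (a (Suc n) (Suc m) (Suc k)) - int (a (Suc n) m (Suc k)))" by simp
  qed simp
  also have "\<dots> = int (a (Suc n) 1 (Suc k)) - int (a (Suc n) k (Suc k))"
    using sum_Suc_diff[of 1 "k-1" "\<lambda>m. int (a (Suc n) m (Suc k))"] assms by simp
  also have "(\<Sum>m=Suc k..n. int (b n m k)) =
      - (\<Sum>m=Suc k..n. int (a (Suc n) (Suc m) k) - int (a (Suc n) m k))"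
    unfolding sum_negf[symmetric]
  proof (rule sum.cong)
    fix m assume "m \<in> {Suc k..n}"
    then have "int (a (Suc n) (m+1) k) - int (a (Suc n) m k) = - int (b n m k)"
      using T(3)[unfolded TS5_def, rule_format, of "Suc n"] assms by force
    then show "int (b n m k) = - (int (a (Suc n) (Suc m) k) - int (a (Suc n) m k))" by simp
  qed simp
  also have "\<dots> = int (a (Suc n) (Suc k) k) - int (a (Suc n) (Suc n) k)"
    using sum_Suc_diff[of "Suc k" "n" "\<lambda>m. int (a (Suc n) m k)"] assms by simp
  also have "a (Suc n) (Suc n) k = 0"
    using T(2) assms by (simp add: TS2_def)
  finally show ?thesis by simp
qed

text \<open>The same telescoping, now starting from \<open>b (Suc n) n k\<close> and using the zero
  top row of \<open>b\<close>. The bound \<open>3 \<le> n\<close> keeps clear of the nonzero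
  diagonal entry \<open>a 2 1 1\<close>.\<close>

lemma twin_seidel_b_symmetric:
  assumes "twin_seidel a b" "1 \<le> k" "k < n" "3 \<le> n"
  shows "b (Suc n) k (Suc k) = b (Suc n) (Suc k) k"
proof -
  have T: "TS1 a b" "TS2 a b" "TS4 a b" using assms(1) by (auto simp: twin_seidel_def)
  have split: "{1..n} = {1..k-1} \<union> {k} \<union> {Suc k..n-1} \<union> {n}" using assms by auto
  have "int (b (Suc n) n k) = int (col_sum a n k)"
    using T(3)[unfolded TS4_def, rule_format, of "Suc n"] assms by simp
  also have "\<dots> = (\<Sum>m=1..k-1. int (a n m k)) + int (a n k k) + (\<Sum>m=Suc k..n-1. int (a n m k))
      + int (a n n k)"
    unfolding col_sum_def split using assms by (subst sum.union_disjoint; auto)+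
  also have "a n k k = 0"
    using T(1) assms by (simp add: TS1_def)
  also have "a n n k = 0"
    using T(2) assms by (simp add: TS2_def)
  also have "(\<Sum>m=1..k-1. int (a n m k)) =
      (\<Sum>m=1..k-1. int (b (Suc n) (Suc m) (Suc k)) - int (b (Suc n) m (Suc k)))"
  proof (rule sum.cong)
    fix m assume "m \<in> {1..k-1}"
    then have "int (b (Suc n) (m+1) (Suc k)) - int (b (Suc n) m (Suc k)) = int (a n m k)"
      using T(3)[unfolded TS4_def, rule_format, of "Suc n"] assms by force
    then show "int (a n m k) = int (b (Suc n) (Suc m) (Suc k)) - int (b (Suc n) m (Suc k))" by simp
  qed simp
  also have "\<dots> = int (b (Suc n) k (Suc k)) - int (b (Suc n) 1 (Suc k))"
    using sum_Suc_diff[of 1 "k-1" "\<lambda>m. int (b (Suc n) m (Suc k))"] assms by simp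
  also have "b (Suc n) 1 (Suc k) = 0"
    using T(2) assms by (simp add: TS2_def)
  also have "(\<Sum>m=Suc k..n-1. int (a n m k)) =
      (\<Sum>m=Suc k..n-1. int (b (Suc n) (Suc m) k) - int (b (Suc n) m k))"
  proof (rule sum.cong)
    fix m assume "m \<in> {Suc k..n-1}"
    then have "int (b (Suc n) (m+1) k) - int (b (Suc n) m k) = int (a n m k)"
      using T(3)[unfolded TS4_def, rule_format, of "Suc n"] assms by force
    then show "int (a n m k) = int (b (Suc n) (Suc m) k) - int (b (Suc n) m k)" by simp
  qed simp
  also have "\<dots> = int (b (Suc n) n k) - int (b (Suc n) (Suc k) k)"
    using sum_Suc_diff[of "Suc k" "n-1" "\<lambda>m. int (b (Suc n) m k)"] assms by simp
  finally show ?thesis by simp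
qed

definition upper_entry :: "(nat \<Rightarrow> nat \<Rightarrow> nat \<Rightarrow> nat) \<Rightarrow> nat \<Rightarrow> nat \<Rightarrow> nat \<Rightarrow> rat" where
  "upper_entry a i j l = of_nat (a (i + j + l + 3) (i + 1) (i + j + 2))"

text \<open>For size \<open>n\<close> this means \<open>i = n - 1 - m\<close>, so the bottom row
  \<open>m = n\<close> is left out, although it need not vanish for \<open>b\<close>.\<close>

definition lower_entry :: "(nat \<Rightarrow> nat \<Rightarrow> nat \<Rightarrow> nat) \<Rightarrow> nat \<Rightarrow> nat \<Rightarrow> nat \<Rightarrow> rat" where
  "lower_entry a i j l = of_nat (a (i + j + l + 3) (j + l + 2) (l + 1))"

text \<open>The matrix size exceeds the degree by 3, so even degrees belong to odd sizes and odd
  degrees to even sizes.\<close>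

definition even_part :: "(nat \<Rightarrow> nat \<Rightarrow> nat \<Rightarrow> rat) \<Rightarrow> nat \<Rightarrow> nat \<Rightarrow> nat \<Rightarrow> rat" where
  "even_part f i j l = (if even (i + j + l) then f i j l else 0)"

definition odd_part :: "(nat \<Rightarrow> nat \<Rightarrow> nat \<Rightarrow> rat) \<Rightarrow> nat \<Rightarrow> nat \<Rightarrow> nat \<Rightarrow> rat" where
  "odd_part f i j l = (if odd (i + j + l) then f i j l else 0)"

lemma of_nat_rat_diff_eqI:
  "int x - int y = int z \<Longrightarrow> (of_nat x :: rat) = of_nat y + of_nat z"
  by (metis add.commute diff_add_cancel of_nat_add of_nat_eq_iff)

text \<open>
  The parity restriction is essential: without it the near-diagonal symmetry of \<open>b\<close> fails at \<open>n = 3\<close>, where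
  \<open>b\<^sub>3(2,1) = 1\<close> and \<open>b\<^sub>3(1,2) = 0\<close>.
\<close>

lemma twin_rec_entries:
  assumes "twin_seidel a b"
  shows "twin_rec (even_part (upper_entry a)) (odd_part (upper_entry b))
           (even_part (lower_entry a)) (odd_part (lower_entry b))"
proof -
  have T: "TS1 a b" "TS2 a b" "TS3 a b" "TS4 a b" "TS5 a b"
    using assms by (auto simp: twin_seidel_def)
  have ub0: "upper_entry b 0 j l = 0" for j l
    using T(2)[unfolded TS2_def, rule_format, of "j + l + 3"] by (simp add: upper_entry_def)
  have ub: "upper_entry b (Suc i) j l = upper_entry b i (Suc j) l + upper_entry a i j l" for i j l
  proof -
    have "int (b (i + j + l + 4) (i + 1 + 1) (i + j + 3)) - int (b (i + j + l + 4) (i + 1) (i + j + 3)) =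
            int (a (i + j + l + 4 - 1) (i + 1) (i + j + 3 - 1))"
      using T(4)[unfolded TS4_def, rule_format, of "i + j + l + 4"] by auto
    from of_nat_rat_diff_eqI[OF this] show ?thesis
      by (simp add: upper_entry_def eval_nat_numeral)
  qed
  have ua: "upper_entry a i (Suc j) l = upper_entry a (Suc i) j l + upper_entry b i j l" for i j l
  proof -
    have "int (a (i + j + l + 4) (i + 1 + 1) (i + j + 3)) - int (a (i + j + l + 4) (i + 1) (i + j + 3)) =
            - int (b (i + j + l + 4 - 1) (i + 1) (i + j + 3 - 1))"
      using T(5)[unfolded TS5_def, rule_format, of "i + j + l + 4"] by auto
    then have "int (a (i + j + l + 4) (i + 1) (i + j + 3)) - int (a (i + j + l + 4) (i + 1 + 1) (i + j + 3)) =
            int (b (i + j + l + 4 - 1) (i + 1) (i + j + 3 - 1))" by simp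
    from of_nat_rat_diff_eqI[OF this] show ?thesis
      by (simp add: upper_entry_def eval_nat_numeral)
  qed
  have lb: "lower_entry b i (Suc j) l = lower_entry b (Suc i) j l + lower_entry a i j l" for i j l
  proof -
    have "int (b (i + j + l + 4) (j + l + 2 + 1) (l + 1)) - int (b (i + j + l + 4) (j + l + 2) (l + 1)) =
            int (a (i + j + l + 4 - 1) (j + l + 2) (l + 1))"
      using T(4)[unfolded TS4_def, rule_format, of "i + j + l + 4"] by auto
    from of_nat_rat_diff_eqI[OF this] show ?thesis
      by (simp add: lower_entry_def eval_nat_numeral)
  qed
  \<comment> \<open>The case \<open>i = 0\<close> is included: there the second entry lies in the
    bottom row, which yields \<open>la_edge\<close>.\<close>
  have T5: "int (a (i + j + l + 3) (j + l + 2) (l + 1)) - int (a (i + j + l + 3) (j + l + 2 + 1) (l + 1)) =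
            int (b (i + j + l + 3 - 1) (j + l + 2) (l + 1))" for i j l
  proof -
    have "int (a (i + j + l + 3) (j + l + 2 + 1) (l + 1)) - int (a (i + j + l + 3) (j + l + 2) (l + 1)) =
            - int (b (i + j + l + 3 - 1) (j + l + 2) (l + 1))"
      using T(5)[unfolded TS5_def, rule_format, of "i + j + l + 3"] by auto
    then show ?thesis by simp
  qed
  have la: "lower_entry a (Suc i) j l = lower_entry a i (Suc j) l + lower_entry b i j l" for i j l
    using of_nat_rat_diff_eqI[OF T5[of "Suc i" j l]] by (simp add: lower_entry_def eval_nat_numeral)
  have la_edge: "a (j + l + 3) (j + l + 2) (l + 1) = b (j + l + 2) (j + l + 2) (l + 1)" for j l
  proof -
    have "a (j + l + 3) (j + l + 3) (l + 1) = 0"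
      using T(2)[unfolded TS2_def, rule_format, of "j + l + 3"] by simp
    then show ?thesis using T5[of 0 j l] by (simp add: eval_nat_numeral)
  qed
  have la0: "lower_entry a 0 j 0 = (if j = 0 then 1 else 0)" for j
  proof (cases j)
    case 0
    \<comment> \<open>The seed of the recursion is \<open>b 2 2 1 = 1\<close>.\<close>
    then show ?thesis using la_edge[of 0 0] T(3) by (simp add: lower_entry_def TS3_def eval_nat_numeral)
  next
    case (Suc i)
    have "b (j + 2) (j + 2) 1 = 0"
      using T(2)[unfolded TS2_def, rule_format, of "j + 2"] Suc by simp
    then show ?thesis using la_edge[of j 0] Suc by (simp add: lower_entry_def)
  qed
  have la1: "lower_entry a 0 j (Suc l) = lower_entry b 0 j l" for j l
  proof -
    \<comment> \<open>The last two rows of \<open>b\<close> list the same column sums of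
      \<open>a\<close>, shifted by one column. This replaces the bottom row, which
      \<open>lower_entry\<close> does not see, by the row above it.\<close>
    have "b (j + l + 3) (j + l + 3) (l + 2) = col_sum a (j + l + 3 - 1) (l + 2 - 1)"
         "b (j + l + 3) (j + l + 3 - 1) (l + 1) = col_sum a (j + l + 3 - 1) (l + 1)"
      using T(4)[unfolded TS4_def, rule_format, of "j + l + 3"] by auto
    then show ?thesis using la_edge[of j "Suc l"]
      by (simp add: lower_entry_def eval_nat_numeral)
  qed
  have ua_diag: "upper_entry a i 0 l = lower_entry a l 0 i" for i l
    using twin_seidel_a_symmetric[OF assms, of "i + 1" "i + l + 2"]
    by (simp add: upper_entry_def lower_entry_def eval_nat_numeral add.commute)
  have ub_diag: "lower_entry b i 0 l = upper_entry b l 0 i" if "odd (i + l)" for i l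
  proof -
    \<comment> \<open>Oddness supplies the size bound \<open>3 \<le> i + l + 2\<close> of the
      symmetry lemma.\<close>
    have "i + l \<ge> 1" using that by (cases "i + l") auto
    then show ?thesis
      using twin_seidel_b_symmetric[OF assms, of "l + 1" "i + l + 2"]
      by (simp add: upper_entry_def lower_entry_def eval_nat_numeral add.commute)
  qed
  show ?thesis
    unfolding twin_rec_def even_part_def odd_part_def
    using ub0 ub lb la la0 la1 ua ua_diag ub_diag by (auto simp: add.commute)
qed

section \<open>Trigonometric series of linear forms\<close>

text \<open>The multinomial expansion of f(px + qy + rz), where f has exponential coefficients
  \<open>c\<close>. It serves sine and cosine alike.\<close>

definition lin3 :: "(nat \<Rightarrow> rat) \<Rightarrow> rat \<Rightarrow> rat \<Rightarrow> rat \<Rightarrow> fps3" where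
  "lin3 c p q r = Abs_fps (\<lambda>i. Abs_fps (\<lambda>j. Abs_fps (\<lambda>l.
     c (i + j + l) * p ^ i * q ^ j * r ^ l / (fact i * fact j * fact l))))"

lemma lin3_nth:
  "lin3 c p q r $ i $ j $ l = c (i + j + l) * p ^ i * q ^ j * r ^ l / (fact i * fact j * fact l)"
  by (simp add: lin3_def)

lemma varx_mult_nth: "(varx * F) $ i $ j $ l = (if i = 0 then 0 else F $ (i - 1) $ j $ l)"
  by (simp add: varx_def)

lemma vary_mult_nth: "(vary * F) $ i $ j $ l = (if j = 0 then 0 else F $ i $ (j - 1) $ l)"
  by (simp add: vary_def)

lemma varz_mult_nth: "(varz * F) $ i $ j $ l = (if l = 0 then 0 else F $ i $ j $ (l - 1))"
  by (simp add: varz_def)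

text \<open>The multinomial theorem. Peeling off one factor gives three terms with weights
  \<open>i\<close>, \<open>j\<close>, \<open>l\<close>, whose sum \<open>Suc n\<close> turns
  \<open>fact n\<close> into \<open>fact (Suc n)\<close>.\<close>

lemma linear_form_power_nth:
  "((const3 p * varx + const3 q * vary + const3 r * varz) ^ n) $ i $ j $ l =
     (if i + j + l = n then fact n * p ^ i * q ^ j * r ^ l / (fact i * fact j * fact l) else 0)"
proof (induction n arbitrary: i j l)
  case 0
  then show ?case by (auto simp: fps_one_nth)
next
  case (Suc n)
  let ?g = "const3 p * varx + const3 q * vary + const3 r * varz"
  have x: "p * (if i = 0 then 0 else if i - 1 + j + l = n
        then fact n * p ^ (i - 1) * q ^ j * r ^ l / (fact (i - 1) * fact j * fact l) else 0) =
      (if i + j + l = Suc n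
        then fact n * of_nat i * p ^ i * q ^ j * r ^ l / (fact i * fact j * fact l) else 0)"
    by (cases i) (auto simp: divide_simps simp del: of_nat_Suc)
  have y: "q * (if j = 0 then 0 else if i + (j - 1) + l = n
        then fact n * p ^ i * q ^ (j - 1) * r ^ l / (fact i * fact (j - 1) * fact l) else 0) =
      (if i + j + l = Suc n
        then fact n * of_nat j * p ^ i * q ^ j * r ^ l / (fact i * fact j * fact l) else 0)"
    by (cases j) (auto simp: divide_simps simp del: of_nat_Suc)
  have z: "r * (if l = 0 then 0 else if i + j + (l - 1) = n
        then fact n * p ^ i * q ^ j * r ^ (l - 1) / (fact i * fact j * fact (l - 1)) else 0) =
      (if i + j + l = Suc n
        then fact n * of_nat l * p ^ i * q ^ j * r ^ l / (fact i * fact j * fact l) else 0)"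
    by (cases l) (auto simp: divide_simps simp del: of_nat_Suc)
  have "(?g ^ Suc n) $ i $ j $ l = p * (varx * ?g ^ n) $ i $ j $ l + q * (vary * ?g ^ n) $ i $ j $ l
      + r * (varz * ?g ^ n) $ i $ j $ l"
    by (simp add: distrib_right mult.assoc const3_mult_nth)
  also have "\<dots> = (if i + j + l = Suc n
      then fact n * (of_nat i + of_nat j + of_nat l) * p ^ i * q ^ j * r ^ l / (fact i * fact j * fact l)
      else 0)"
    unfolding varx_mult_nth vary_mult_nth varz_mult_nth Suc.IH
    using x y z by (simp add: ring_distribs add_divide_distrib)
  also have "\<dots> = (if i + j + l = Suc n
      then fact (Suc n) * p ^ i * q ^ j * r ^ l / (fact i * fact j * fact l) else 0)"
  proof (cases "i + j + l = Suc n")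
    case True
    then have "(of_nat i + of_nat j + of_nat l :: rat) = of_nat (Suc n)" by (metis of_nat_add)
    then show ?thesis by (simp add: algebra_simps)
  qed simp
  finally show ?case .
qed

definition cos_ecoeff :: "nat \<Rightarrow> rat" where "cos_ecoeff n = fact n * fps_cos 1 $ n"

definition sin_ecoeff :: "nat \<Rightarrow> rat" where "sin_ecoeff n = fact n * fps_sin 1 $ n"

lemma sin_ecoeff_0: "sin_ecoeff 0 = 0"
  by (simp add: sin_ecoeff_def fps_sin_def)

lemma cos_ecoeff_Suc: "cos_ecoeff (Suc n) = - sin_ecoeff n"
proof -
  have "fps_deriv (fps_cos (1::rat)) $ n = - (fps_sin 1 $ n)"
    by (simp add: fps_cos_deriv)
  then have "of_nat (Suc n) * fps_cos (1::rat) $ Suc n = - (fps_sin 1 $ n)"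
    by simp
  then show ?thesis
    unfolding cos_ecoeff_def sin_ecoeff_def fact_Suc mult.assoc mult.left_commute[of "of_nat (Suc n)"] by simp
qed

lemma sin_ecoeff_Suc: "sin_ecoeff (Suc n) = cos_ecoeff n"
proof -
  have "fps_deriv (fps_sin (1::rat)) $ n = fps_cos 1 $ n"
    by (simp add: fps_sin_deriv)
  then have "of_nat (Suc n) * fps_sin (1::rat) $ Suc n = fps_cos 1 $ n"
    by simp
  then show ?thesis
    unfolding cos_ecoeff_def sin_ecoeff_def fact_Suc mult.assoc mult.left_commute[of "of_nat (Suc n)"] by simp
qed

lemma cos3_linear_form:
  "cos3 (const3 p * varx + const3 q * vary + const3 r * varz) = lin3 cos_ecoeff p q r"
proof -
  have "(const3 p * varx + const3 q * vary + const3 r * varz) $ 0 $ 0 $ 0 = 0"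
    using linear_form_power_nth[of p q r 1 0 0 0] by simp
  then show ?thesis
    unfolding fps_eq_iff cos3_def by (simp add: subst3_nth linear_form_power_nth lin3_nth cos_ecoeff_def
       if_distrib if_distribR sum.delta cong: if_cong)
qed

section \<open>Derivations and specialisations\<close>

text \<open>Polymorphic because it is used twice: as the y-derivative on \<open>fps3\<close>, and as
  the z-derivative after setting x = 0.\<close>

definition fps_deriv2 :: "'a::comm_ring_1 fps fps \<Rightarrow> 'a fps fps" where
  "fps_deriv2 F = Abs_fps (\<lambda>i. fps_deriv (F $ i))"

lemma fps_deriv2_nth: "fps_deriv2 F $ i = fps_deriv (F $ i)"
  by (simp add: fps_deriv2_def)

lemma fps_deriv2_mult: "fps_deriv2 (F * G) = fps_deriv2 F * G + F * fps_deriv2 G"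
  by (rule fps_ext) (simp add: fps_deriv2_nth fps_mult_nth fps_deriv_sum sum.distrib add.commute)

definition deriv_xy :: "fps3 \<Rightarrow> fps3" where
  "deriv_xy F = fps_deriv F - fps_deriv2 F"

lemma deriv_xy_mult: "deriv_xy (F * G) = deriv_xy F * G + F * deriv_xy G"
  by (simp add: deriv_xy_def fps_deriv2_mult algebra_simps)

lemma deriv_xy_nth:
  "deriv_xy F $ i $ j $ l = of_nat (Suc i) * F $ Suc i $ j $ l - of_nat (Suc j) * F $ i $ Suc j $ l"
  unfolding deriv_xy_def fps_sub_nth fps_deriv2_nth fps_deriv_nth
  by (simp flip: fps_of_nat add: distrib_right)

text \<open>The chain rule. Forms with \<open>p = q\<close> are annihilated, in particular those in
  x + y + z and in x + y.\<close>

lemma deriv_xy_lin3: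
  "deriv_xy (lin3 c p q r) = const3 (p - q) * lin3 (\<lambda>n. c (Suc n)) p q r"
  unfolding fps_eq_iff deriv_xy_nth lin3_nth const3_mult_nth
  by (auto simp: field_simps simp del: of_nat_Suc)

text \<open>A constant \<open>H\<close> of the derivation passes through the product rule and can be
  cancelled.\<close>

lemma deriv_xy_quotient:
  assumes "F * H = P" "G * H = deriv_xy P" "deriv_xy H = 0" "H \<noteq> 0"
  shows "deriv_xy F = G"
proof -
  have "deriv_xy F * H = G * H"
    using deriv_xy_mult[of F H] assms by simp
  then show ?thesis using assms(4) by simp
qed

text \<open>Setting y = 0 selects the entries next to the diagonal. The companion
  \<open>diag_zx\<close> also swaps x and z, as the symmetry between upper and lower entries
  demands.\<close>

definition diag_xz :: "fps3 \<Rightarrow> rat fps fps" where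
  "diag_xz F = Abs_fps (\<lambda>i. Abs_fps (\<lambda>l. F $ i $ 0 $ l))"

definition diag_zx :: "fps3 \<Rightarrow> rat fps fps" where
  "diag_zx F = Abs_fps (\<lambda>i. Abs_fps (\<lambda>l. F $ l $ 0 $ i))"

lemma diag_xz_mult: "diag_xz (F * G) = diag_xz F * diag_xz G"
  by (simp add: fps_eq_iff diag_xz_def fps_mult_nth fps_sum_nth)

lemma diag_zx_mult: "diag_zx (F * G) = diag_zx F * diag_zx G"
  unfolding fps_eq_iff by (simp add: diag_zx_def fps_mult_nth fps_sum_nth) (intro allI sum.swap)

lemma diag_eqI:
  assumes "F * H = P" "G * H = Q" "diag_xz H = diag_zx H" "diag_xz P = diag_zx Q"
    and "H $ 0 $ 0 $ 0 \<noteq> 0"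
  shows "F $ i $ 0 $ l = G $ l $ 0 $ i"
proof -
  have "diag_xz F * diag_xz H = diag_zx G * diag_xz H"
    using assms by (metis diag_xz_mult diag_zx_mult)
  moreover have "diag_xz H $ 0 $ 0 \<noteq> 0" using assms(5) by (simp add: diag_xz_def)
  then have "diag_xz H \<noteq> 0" by auto
  ultimately have "diag_xz F $ i $ l = diag_zx G $ i $ l" by simp
  then show ?thesis by (simp add: diag_xz_def diag_zx_def)
qed

section \<open>The closed forms satisfy the recursion\<close>

definition ecoeff :: "fps3 \<Rightarrow> nat \<Rightarrow> nat \<Rightarrow> nat \<Rightarrow> rat" where
  "ecoeff F i j l = fact i * fact j * fact l * F $ i $ j $ l"

lemma ecoeff_deriv_xy: "ecoeff (deriv_xy F) i j l = ecoeff F (Suc i) j l - ecoeff F i (Suc j) l"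
  by (simp add: ecoeff_def deriv_xy_nth algebra_simps)

text \<open>The quotients enter only through their products with \<open>H\<close>, so every relation
  is checked on numerators and a nonzero factor is cancelled.\<close>

lemma twin_rec_closed_form:
  fixes H :: fps3
  defines "H \<equiv> (lin3 cos_ecoeff 1 1 1)\<^sup>2"
  assumes ua: "UA * H = lin3 cos_ecoeff 1 0 0 * lin3 cos_ecoeff 0 0 1"
    and ub: "UB * H = lin3 sin_ecoeff 1 0 0 * lin3 cos_ecoeff 0 0 1"
    and la: "LA * H = lin3 cos_ecoeff 1 1 0 * lin3 cos_ecoeff 0 1 1"
    and lb: "LB * H = lin3 cos_ecoeff 1 1 0 * lin3 sin_ecoeff 0 1 1"
  shows "twin_rec (ecoeff UA) (ecoeff UB) (ecoeff LA) (ecoeff LB)"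
proof -
  have c1: "cos_ecoeff 0 = 1" by (simp add: cos_ecoeff_def)
  have H0: "H $ 0 $ 0 $ 0 = 1"
    by (simp add: H_def power2_eq_square lin3_nth c1)
  then have Hnz: "H \<noteq> 0" by auto
  have dH: "deriv_xy H = 0"
    by (simp add: H_def power2_eq_square deriv_xy_mult deriv_xy_lin3 const3_def)
  have c_neg: "lin3 (\<lambda>n. - c n) p q r = - lin3 c p q r" for c p q r
    by (simp add: fps_eq_iff lin3_nth)
  have const_pm: "const3 1 = 1" "const3 (-1) = -1" "const3 0 = 0"
    by (simp_all add: const3_def flip: fps_const_neg)
  note D = deriv_xy_mult deriv_xy_lin3 cos_ecoeff_Suc sin_ecoeff_Suc c_neg const_pm
  have "deriv_xy UA = - UB"
    by (rule deriv_xy_quotient[OF ua _ dH Hnz]) (simp add: D ub)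
  moreover have "deriv_xy UB = UA"
    by (rule deriv_xy_quotient[OF ub _ dH Hnz]) (simp add: D ua)
  moreover have "deriv_xy LA = LB"
    by (rule deriv_xy_quotient[OF la _ dH Hnz]) (simp add: D lb)
  moreover have "deriv_xy LB = - LA"
    by (rule deriv_xy_quotient[OF lb _ dH Hnz]) (simp add: D la)
  ultimately have rec:
    "ecoeff UA (Suc i) j l - ecoeff UA i (Suc j) l = - ecoeff UB i j l"
    "ecoeff UB (Suc i) j l - ecoeff UB i (Suc j) l = ecoeff UA i j l"
    "ecoeff LA (Suc i) j l - ecoeff LA i (Suc j) l = ecoeff LB i j l"
    "ecoeff LB (Suc i) j l - ecoeff LB i (Suc j) l = - ecoeff LA i j l" for i j l
    unfolding ecoeff_deriv_xy[symmetric] by (simp_all add: ecoeff_def)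
  have H_diag: "diag_xz H = diag_zx H"
    unfolding H_def power2_eq_square diag_xz_mult diag_zx_mult
    by (simp add: fps_eq_iff diag_xz_def diag_zx_def lin3_nth add.commute mult.commute)
  have "UA $ i $ 0 $ l = LA $ l $ 0 $ i" for i l
  proof (rule diag_eqI[OF ua la H_diag])
    \<comment> \<open>At y = 0 the factors cos (y + z) and cos (x + y) become cos z and cos x, which
      the swap of x and z exchanges.\<close>
    have "diag_xz (lin3 cos_ecoeff 1 0 0) = diag_zx (lin3 cos_ecoeff 0 1 1)"
         "diag_xz (lin3 cos_ecoeff 0 0 1) = diag_zx (lin3 cos_ecoeff 1 1 0)"
      by (simp_all add: fps_eq_iff diag_xz_def diag_zx_def lin3_nth power_0_left)
    then show "diag_xz (lin3 cos_ecoeff 1 0 0 * lin3 cos_ecoeff 0 0 1) =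
        diag_zx (lin3 cos_ecoeff 1 1 0 * lin3 cos_ecoeff 0 1 1)"
      by (simp add: diag_xz_mult diag_zx_mult mult.commute)
  qed (simp add: H0)
  then have ua_diag: "ecoeff UA i 0 l = ecoeff LA l 0 i" for i l
    by (simp add: ecoeff_def)
  have "LB $ i $ 0 $ l = UB $ l $ 0 $ i" for i l
  proof (rule diag_eqI[OF lb ub H_diag])
    have "diag_xz (lin3 cos_ecoeff 1 1 0) = diag_zx (lin3 cos_ecoeff 0 0 1)"
         "diag_xz (lin3 sin_ecoeff 0 1 1) = diag_zx (lin3 sin_ecoeff 1 0 0)"
      by (simp_all add: fps_eq_iff diag_xz_def diag_zx_def lin3_nth power_0_left)
    then show "diag_xz (lin3 cos_ecoeff 1 1 0 * lin3 sin_ecoeff 0 1 1) =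
        diag_zx (lin3 sin_ecoeff 1 0 0 * lin3 cos_ecoeff 0 0 1)"
      by (simp add: diag_xz_mult diag_zx_mult mult.commute)
  qed (simp add: H0)
  then have lb_diag: "ecoeff LB i 0 l = ecoeff UB l 0 i" for i l
    by (simp add: ecoeff_def)
  have H0nz: "H $ 0 \<noteq> 0" using H0 by auto
  have "UB $ 0 * H $ 0 = 0"
  proof -
    have "lin3 sin_ecoeff 1 0 0 $ 0 = 0"
      by (simp add: fps_eq_iff lin3_nth power_0_left sin_ecoeff_0)
    then show ?thesis using arg_cong[OF ub, of "\<lambda>F. F $ 0"] by simp
  qed
  then have ub0: "ecoeff UB 0 j l = 0" for j l
    using H0nz by (simp add: ecoeff_def)
  \<comment> \<open>At x = 0 these are cos y, cos (y + z) and sin (y + z). There \<open>LA\<close>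
    is u/v and \<open>LB\<close> is uw/v^2, the z-derivative of u/v, as u is free of z.\<close>
  define u :: "rat fps fps" where "u = lin3 cos_ecoeff 1 1 0 $ 0"
  define v :: "rat fps fps" where "v = lin3 cos_ecoeff 1 1 1 $ 0"
  define w :: "rat fps fps" where "w = lin3 sin_ecoeff 0 1 1 $ 0"
  have uv: "lin3 cos_ecoeff 0 1 1 $ 0 = v" by (simp add: v_def fps_eq_iff lin3_nth)
  have "v $ 0 $ 0 \<noteq> 0" by (simp add: v_def lin3_nth c1)
  then have vnz: "v \<noteq> 0" by auto
  have Hv: "H $ 0 = v * v" by (simp add: H_def power2_eq_square v_def)
  have LAv: "LA $ 0 * v = u"
  proof -
    have "(LA $ 0 * v) * v = u * v"
      using arg_cong[OF la, of "\<lambda>F. F $ 0"] by (simp add: uv u_def Hv mult.assoc)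
    then show ?thesis using vnz by simp
  qed
  have LBv: "LB $ 0 * v * v = u * w"
    using arg_cong[OF lb, of "\<lambda>F. F $ 0"] by (simp add: w_def u_def Hv mult.assoc)
  have dv: "fps_deriv2 v = - w"
    unfolding fps_eq_iff fps_deriv2_nth v_def w_def
    by (simp add: lin3_nth cos_ecoeff_Suc divide_simps del: of_nat_Suc)
  have du: "fps_deriv2 u = 0"
    unfolding fps_eq_iff fps_deriv2_nth u_def by (simp add: lin3_nth)
  have "fps_deriv2 (LA $ 0) * v = LA $ 0 * w"
    using fps_deriv2_mult[of "LA $ 0" v] by (simp add: LAv du dv)
  then have "fps_deriv2 (LA $ 0) * v * v = LB $ 0 * v * v"
    unfolding LBv LAv[symmetric] by (simp add: mult_ac)
  then have dLA: "fps_deriv2 (LA $ 0) = LB $ 0" using vnz by simp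
  have la1: "ecoeff LA 0 j (Suc l) = ecoeff LB 0 j l" for j l
    unfolding ecoeff_def dLA[symmetric] fps_deriv2_nth by (simp add: algebra_simps)
  \<comment> \<open>Setting z = 0 as well makes both \<open>u\<close> and \<open>v\<close> equal to
    cos y, so \<open>LA\<close> becomes 1.\<close>
  define z0 :: "rat fps fps \<Rightarrow> rat fps" where "z0 F = Abs_fps (\<lambda>j. F $ j $ 0)" for F
  have z0_mult: "z0 (F * G) = z0 F * z0 G" for F G
    by (simp add: z0_def fps_eq_iff fps_mult_nth fps_sum_nth)
  have "z0 u = z0 v"
    by (simp add: z0_def fps_eq_iff u_def v_def lin3_nth)
  moreover have "z0 v $ 0 \<noteq> 0" using \<open>v $ 0 $ 0 \<noteq> 0\<close> by (simp add: z0_def)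
  then have "z0 v \<noteq> 0" by auto
  ultimately have "z0 (LA $ 0) = 1"
    using arg_cong[OF LAv, of z0] by (simp add: z0_mult)
  then have "LA $ 0 $ j $ 0 = (if j = 0 then 1 else 0)" for j
    unfolding z0_def fps_eq_iff by (simp add: fps_one_nth)
  then have la0: "ecoeff LA 0 j 0 = (if j = 0 then 1 else 0)" for j
    by (simp add: ecoeff_def)
  show ?thesis
    unfolding twin_rec_def using ub0 rec lb_diag la0 la1 ua_diag
    by (auto simp: algebra_simps)
qed

section \<open>Comparing coefficients of the formal sums\<close>

lemma monomial3_nth:
  "(const3 c * varx ^ p * vary ^ q * varz ^ r) $ i $ j $ l = (if i = p \<and> j = q \<and> l = r then c else 0)"
proof -
  have x: "(varx ^ p * F) $ i $ j $ l = (if i < p then 0 else F $ (i - p) $ j $ l)" for F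
    by (simp add: varx_def fps_X_power_mult_nth)
  have y: "(vary ^ q * F) $ i $ j $ l = (if j < q then 0 else F $ i $ (j - q) $ l)" for F i
    by (simp add: vary_def fps_const_power fps_X_power_mult_nth)
  have z: "varz ^ r $ i $ j $ l = (if i = 0 \<and> j = 0 \<and> l = r then 1 else 0)" for i j
    by (simp add: varz_def fps_const_power fps_X_power_nth)
  show ?thesis
    unfolding mult.assoc const3_mult_nth x y z by auto
qed

text \<open>Each monomial receives a contribution from at most one index. \<open>T\<close> names the
  only candidate, which may lie outside \<open>I\<close>.\<close>

lemma has_formal_sum_singleI:
  assumes "\<And>t i j l. t \<in> I \<Longrightarrow> F t $ i $ j $ l \<noteq> 0 \<Longrightarrow> t = T i j l"
    and "\<And>i j l. S $ i $ j $ l = (if T i j l \<in> I then F (T i j l) $ i $ j $ l else 0)"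
  shows "has_formal_sum F I S"
proof -
  have sub: "{t \<in> I. F t $ i $ j $ l \<noteq> 0} \<subseteq> {T i j l}" for i j l
    using assms(1) by blast
  have "(\<Sum>t | t \<in> I \<and> F t $ i $ j $ l \<noteq> 0. F t $ i $ j $ l) = S $ i $ j $ l" for i j l
  proof (cases "T i j l \<in> I \<and> F (T i j l) $ i $ j $ l \<noteq> 0")
    case True
    then have "{t. t \<in> I \<and> F t $ i $ j $ l \<noteq> 0} = {T i j l}" using sub[of i j l] by auto
    then show ?thesis using True assms(2) by simp
  next
    case False
    then have "{t. t \<in> I \<and> F t $ i $ j $ l \<noteq> 0} = {}" using sub[of i j l] by auto
    then show ?thesis using False assms(2) by auto
  qed
  then show ?thesis
    unfolding has_formal_sum_def formal_summable_def formal_sum_def fps_eq_iff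
    using finite_subset[OF sub] by simp
qed

theorem theorem1p4:
  fixes a b :: "nat \<Rightarrow> nat \<Rightarrow> nat \<Rightarrow> nat"
  assumes "twin_seidel a b"
  shows "has_formal_sum
           (\<lambda>(n, m, k). const3 (of_nat (a (2 * n + 1) m k) /
                                (fact (m - 1) * fact (k - m - 1) * fact (2 * n - k)))
                        * varx ^ (m - 1) * vary ^ (k - m - 1) * varz ^ (2 * n - k))
           {(n, m, k). 1 \<le> n \<and> 2 \<le> m + 1 \<and> m + 1 \<le> k \<and> k \<le> 2 * n}
           (cos3 varx * cos3 varz / (cos3 (varx + vary + varz))\<^sup>2)
       \<and> has_formal_sum
           (\<lambda>(n, m, k). const3 (of_nat (a (2 * n + 1) m k) /
                                (fact (2 * n - m) * fact (m - k - 1) * fact (k - 1)))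
                        * varx ^ (2 * n - m) * vary ^ (m - k - 1) * varz ^ (k - 1))
           {(n, m, k). 1 \<le> n \<and> 2 \<le> k + 1 \<and> k + 1 \<le> m \<and> m \<le> 2 * n}
           (cos3 (varx + vary) * cos3 (vary + varz) / (cos3 (varx + vary + varz))\<^sup>2)"
    (is "has_formal_sum ?F ?I ?UA \<and> has_formal_sum ?G ?J ?LA")
proof
  let ?H = "(cos3 (varx + vary + varz))\<^sup>2"
  have const3_01: "const3 1 = 1" "const3 0 = 0" by (simp_all add: const3_def)
  have cos3_eqs: "cos3 varx = lin3 cos_ecoeff 1 0 0" "cos3 varz = lin3 cos_ecoeff 0 0 1"
      "cos3 (varx + vary + varz) = lin3 cos_ecoeff 1 1 1"
      "cos3 (varx + vary) = lin3 cos_ecoeff 1 1 0" "cos3 (vary + varz) = lin3 cos_ecoeff 0 1 1"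
    by (simp_all add: cos3_linear_form[symmetric] const3_01)
  have "?H $ 0 $ 0 $ 0 \<noteq> 0"
    by (simp add: cos3_eqs power2_eq_square lin3_nth cos_ecoeff_def)
  then have quot: "F / ?H * ?H = F" for F by (rule fps3_divide)
  \<comment> \<open>The sine quotients are the companion series for \<open>b\<close> that close the
    system.\<close>
  have "twin_rec (ecoeff ?UA) (ecoeff (lin3 sin_ecoeff 1 0 0 * lin3 cos_ecoeff 0 0 1 / ?H))
          (ecoeff ?LA) (ecoeff (lin3 cos_ecoeff 1 1 0 * lin3 sin_ecoeff 0 1 1 / ?H))"
    by (rule twin_rec_closed_form) (use quot in \<open>simp_all only: cos3_eqs\<close>)
  from twin_rec_unique[OF this twin_rec_entries[OF assms]]
  have "ecoeff ?UA i j l = even_part (upper_entry a) i j l"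
       "ecoeff ?LA i j l = even_part (lower_entry a) i j l" for i j l
    by blast+
  then have UA: "?UA $ i $ j $ l = even_part (upper_entry a) i j l / (fact i * fact j * fact l)"
    and LA: "?LA $ i $ j $ l = even_part (lower_entry a) i j l / (fact i * fact j * fact l)" for i j l
    by (simp_all add: ecoeff_def nonzero_eq_divide_eq mult_ac)
  show "has_formal_sum ?F ?I ?UA"
  \<comment> \<open>Solving the exponents for the indices; the size \<open>2 * n + 1\<close> must
    equal \<open>i + j + l + 3\<close>.\<close>
  proof (rule has_formal_sum_singleI[where T = "\<lambda>i j l. ((i + j + l) div 2 + 1, i + 1, i + j + 2)"],
         goal_cases)
    case (1 t i j l)
    obtain n m k where t: "t = (n, m, k)" by (cases t) auto
    have "i = m - 1 \<and> j = k - m - 1 \<and> l = 2 * n - k"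
      using 1 unfolding t by (auto simp: monomial3_nth split: if_splits)
    then show ?case using 1(1) unfolding t by auto
  next
    case (2 i j l)
    define h where "h = (i + j + l) div 2"
    have h: "(i + j + l) div 2 = h" "i + j + l = 2 * h \<or> i + j + l = 2 * h + 1"
      unfolding h_def by presburger+
    show ?case
    proof (cases "even (i + j + l)")
      case True
      then have "i + j + l = 2 * h" using h(2) by presburger
      then show ?thesis
        unfolding UA even_part_def prod.case monomial3_nth h(1)
        by (auto simp: upper_entry_def numeral_3_eq_3)
    next
      case False
      \<comment> \<open>In odd degree the candidate carries exponent \<open>l - 1\<close> of z, or
        for \<open>l = 0\<close> leaves the index set.\<close>
      then have "i + j + l = 2 * h + 1" using h(2) by presburger
      then show ?thesis
        unfolding UA even_part_def prod.case monomial3_nth h(1)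
        by auto
    qed
  qed
  show "has_formal_sum ?G ?J ?LA"
  proof (rule has_formal_sum_singleI[where T = "\<lambda>i j l. ((i + j + l) div 2 + 1, j + l + 2, l + 1)"],
         goal_cases)
    case (1 t i j l)
    obtain n m k where t: "t = (n, m, k)" by (cases t) auto
    have "i = 2 * n - m \<and> j = m - k - 1 \<and> l = k - 1"
      using 1 unfolding t by (auto simp: monomial3_nth split: if_splits)
    then show ?case using 1(1) unfolding t by auto
  next
    case (2 i j l)
    define h where "h = (i + j + l) div 2"
    have h: "(i + j + l) div 2 = h" "i + j + l = 2 * h \<or> i + j + l = 2 * h + 1"
      unfolding h_def by presburger+
    show ?case
    proof (cases "even (i + j + l)")
      case True
      then have "i + j + l = 2 * h" using h(2) by presburger
      then show ?thesis
        unfolding LA even_part_def prod.case monomial3_nth h(1)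
        by (auto simp: lower_entry_def numeral_3_eq_3)
    next
      case False
      \<comment> \<open>Now the exponent of x is \<open>i - 1\<close>, or for \<open>i = 0\<close>
        the index set is left.\<close>
      then have "i + j + l = 2 * h + 1" using h(2) by presburger
      then show ?thesis
        unfolding LA even_part_def prod.case monomial3_nth h(1)
        by auto
    qed
  qed
qed

end
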